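(* Let $n\in\mathbb N=\{1,2,\dots\}$ and write $n=2^k\,op(n)$ with $k\ge 0$ and $op(n)$ odd. Then $$\hat t(n,x)=\prod_{d\mid op(n)}C(2n/d,x)=\prod_{d\mid op(n)}C(2^{k+1}d,x),$$ the products being over the positive divisors $d$ of $op(n)$.
   Context: $C(n,x)$ is the minimal polynomial over $\mathbb Q$ of $2\cos(\pi/n)$. $\hat t(n,x)=2\,T_n(x/2)$, where $T_n$ is the Chebyshev polynomial of the first kind, so that $\hat t(n,2\cos\theta)=2\cos(n\theta)$. *)

theory Defs
  imports Complex_Main "HOL-Computational_Algebra.Computational_Algebra"
begin

definition is_min_poly_rat :: "'a :: field_char_0 \<Rightarrow> rat poly \<Rightarrow> bool" where
  "is_min_poly_rat x p \<longleftrightarrow>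
     lead_coeff p = 1 \<and> poly (map_poly of_rat p) x = 0 \<and>
     (\<forall>q. q \<noteq> 0 \<longrightarrow> poly (map_poly of_rat q) x = 0 \<longrightarrow> degree p \<le> degree q)"

text \<open>Only meaningful for algebraic \<open>x\<close>; see \<open>is_min_poly_rat_min_poly_rat\<close> below.\<close>

definition min_poly_rat :: "'a :: field_char_0 \<Rightarrow> rat poly" where
  "min_poly_rat x = (THE p. is_min_poly_rat x p)"

definition C_poly :: "nat \<Rightarrow> rat poly" where
  "C_poly n = min_poly_rat (2 * cos (pi / real n))"

fun cheb_T :: "nat \<Rightarrow> 'a :: comm_ring_1 poly" where
  "cheb_T 0 = 1"
| "cheb_T (Suc 0) = [:0, 1:]"
| "cheb_T (Suc (Suc n)) = [:0, 2:] * cheb_T (Suc n) - cheb_T n"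

definition t_hat :: "nat \<Rightarrow> 'a :: field_char_0 poly" where
  "t_hat n = smult 2 (pcompose (cheb_T n) [:0, 1 / 2:])"

lemma map_poly_of_rat_add:
  "map_poly of_rat (p + q) = map_poly of_rat p + (map_poly of_rat q :: 'a :: field_char_0 poly)"
  by (rule poly_eqI) (simp add: coeff_map_poly of_rat_add)

lemma map_poly_of_rat_diff:
  "map_poly of_rat (p - q) = map_poly of_rat p - (map_poly of_rat q :: 'a :: field_char_0 poly)"
  by (rule poly_eqI) (simp add: coeff_map_poly of_rat_diff)

lemma map_poly_of_rat_smult:
  "map_poly of_rat (smult c p) = smult (of_rat c) (map_poly of_rat p :: 'a :: field_char_0 poly)"
  by (rule poly_eqI) (simp add: coeff_map_poly of_rat_mult)

lemma map_poly_of_rat_mult: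
  "map_poly of_rat (p * q) = map_poly of_rat p * (map_poly of_rat q :: 'a :: field_char_0 poly)"
  by (rule poly_eqI) (simp add: coeff_map_poly coeff_mult of_rat_sum of_rat_mult)

lemma is_min_poly_rat_unique:
  assumes p: "is_min_poly_rat x p" and q: "is_min_poly_rat x q"
  shows "p = q"
proof (rule ccontr)
  assume ne: "p \<noteq> q"
  have "p \<noteq> 0" "q \<noteq> 0"
    using p q by (auto simp: is_min_poly_rat_def)
  then have deg: "degree p = degree q"
    using p q unfolding is_min_poly_rat_def by (meson le_antisym)
  have "poly (map_poly of_rat (p - q)) x = 0"
    using p q by (simp add: is_min_poly_rat_def map_poly_of_rat_diff)
  then have le: "degree p \<le> degree (p - q)"
    using p ne by (simp add: is_min_poly_rat_def)
  moreover have "degree (p - q) \<le> degree p"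
    using deg degree_diff_le_max[of p q] by simp
  ultimately have "degree (p - q) = degree p"
    by simp
  then have "lead_coeff (p - q) = 0"
    using p q deg by (simp add: is_min_poly_rat_def)
  then show False
    using ne by (metis leading_coeff_0_iff right_minus_eq)
qed

lemma is_min_poly_rat_min_poly_rat:
  assumes r: "r \<noteq> 0" "poly (map_poly of_rat r) x = 0"
  shows "is_min_poly_rat x (min_poly_rat x)"
proof -
  let ?P = "\<lambda>q. q \<noteq> 0 \<and> poly (map_poly of_rat q) x = 0"
  have "\<exists>p. ?P p \<and> (\<forall>q. ?P q \<longrightarrow> degree p \<le> degree q)"
    using r by (intro ex_has_least_nat[of ?P r degree]) auto
  then obtain p where p: "?P p" "\<forall>q. ?P q \<longrightarrow> degree p \<le> degree q"
    by blast
  have "is_min_poly_rat x (smult (inverse (lead_coeff p)) p)"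
    using p by (auto simp: is_min_poly_rat_def map_poly_of_rat_smult)
  then show ?thesis
    unfolding min_poly_rat_def by (metis is_min_poly_rat_unique theI')
qed

lemma map_poly_of_rat_cheb_T:
  "map_poly of_rat (cheb_T n) = (cheb_T n :: 'a :: field_char_0 poly)"
  by (induction n rule: cheb_T.induct)
     (simp_all add: map_poly_of_rat_diff map_poly_of_rat_mult map_poly_of_rat_smult
       map_poly_pCons)

lemma poly_t_hat: "poly (t_hat n) x = 2 * poly (cheb_T n) (x / 2)"
  by (simp add: t_hat_def poly_pcompose)

lemma poly_cheb_T_cos: "poly (cheb_T n) (cos t) = cos (real n * t)"
proof (induction n rule: cheb_T.induct)
  case (3 n)
  have "cos (real (Suc (Suc n)) * t) + cos (real n * t) = 2 * cos t * cos (real (Suc n) * t)"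
    using cos_add[of "real (Suc n) * t" t] cos_diff[of "real (Suc n) * t" t]
    by (simp add: algebra_simps)
  with 3 show ?case by (simp add: algebra_simps)
qed simp_all

lemma poly_t_hat_cos: "poly (t_hat n) (2 * cos t) = 2 * cos (real n * t)"
  by (simp add: poly_t_hat poly_cheb_T_cos)

lemma poly_map_poly_t_hat:
  "poly (map_poly of_rat (t_hat n)) (x :: 'a :: field_char_0) = poly (t_hat n) x"
proof -
  have "map_poly of_rat (pcompose p q) = pcompose (map_poly of_rat p) (map_poly of_rat q :: 'a poly)"
    for p q
    by (induction p)
       (simp_all add: pcompose_pCons map_poly_pCons map_poly_of_rat_add map_poly_of_rat_mult)
  then show ?thesis
    by (simp add: t_hat_def map_poly_of_rat_smult map_poly_of_rat_cheb_T map_poly_pCons of_rat_divide)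
qed

lemma is_min_poly_rat_C_poly:
  assumes "n \<ge> 1"
  shows "is_min_poly_rat (2 * cos (pi / real n)) (C_poly n)"
proof -
  let ?r = "t_hat n + [:2:] :: rat poly"
  have T1: "poly (cheb_T n) (1 :: rat) = 1"
    by (induction n rule: cheb_T.induct) simp_all
  have "poly ?r 2 = 4"
    by (simp add: poly_t_hat T1)
  then have "?r \<noteq> 0"
    by (metis poly_0 zero_neq_numeral)
  moreover have "poly (map_poly of_rat ?r) (2 * cos (pi / real n)) = 0"
    using assms
    by (simp add: map_poly_of_rat_add poly_map_poly_t_hat poly_t_hat_cos map_poly_pCons)
  ultimately show ?thesis
    unfolding C_poly_def by (rule is_min_poly_rat_min_poly_rat)
qed

end

theory Submission
  imports Defs
begin

text \<open>
  Every root \<open>2 cos (j pi / (2n))\<close>, \<open>j\<close> odd, of \<open>t_hat n\<close> is, after reducing the fraction, of the form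
  \<open>2 cos (i pi / N)\<close> with \<open>N = 2^(k+1) d\<close>, \<open>d\<close> a divisor of \<open>m\<close> and \<open>i\<close> coprime to \<open>N\<close>. The crucial point is that
  it is then a root of \<open>C_poly N\<close>, which is shown one prime factor \<open>q\<close> of \<open>i\<close> at a time, as in Dedekind's
  proof of the irreducibility of cyclotomic polynomials. Let \<open>f\<close> be the minimal polynomial of a root
  \<open>a = 2 cos t\<close> of \<open>t_hat n = f g\<close>, and \<open>c = 2 cos (q t)\<close>, again a root of \<open>t_hat n\<close>. As \<open>c \<equiv> a^q\<close>
  modulo \<open>q\<close> in \<open>\<int>[a]\<close>, also \<open>f(c) \<equiv> f(a)^q = 0\<close>. If \<open>f(c) \<noteq> 0\<close>, then \<open>g(c) = 0\<close> and
  \<open>t_hat n\<close> has derivative \<open>f(c) g'(c) \<equiv> 0\<close> at \<open>c\<close>; but the square of this derivative times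
  \<open>4 - c^2\<close> is \<open>4 n^2\<close>, which is impossible for an odd \<open>q\<close> not dividing \<open>n\<close>.
\<close>

section \<open>Rational and integer polynomials\<close>

abbreviation ipoly :: "int poly \<Rightarrow> 'a :: field_char_0 \<Rightarrow> 'a" where
  "ipoly p x \<equiv> poly (map_poly of_int p) x"

lemma map_poly_of_int_diff:
  "map_poly of_int (p - q) = (map_poly of_int p - map_poly of_int q :: 'a :: field_char_0 poly)"
  by (rule poly_eqI) (simp add: coeff_map_poly)

lemma map_poly_of_int_add:
  "map_poly of_int (p + q) = (map_poly of_int p + map_poly of_int q :: 'a :: field_char_0 poly)"
  by (rule poly_eqI) (simp add: coeff_map_poly)

lemma map_poly_of_int_smult:
  "map_poly of_int (smult c p) = smult (of_int c) (map_poly of_int p :: 'a :: field_char_0 poly)"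
  by (rule poly_eqI) (simp add: coeff_map_poly)

lemma map_poly_of_int_mult:
  "map_poly of_int (p * q) = (map_poly of_int p * map_poly of_int q :: 'a :: field_char_0 poly)"
  by (rule poly_eqI) (simp add: coeff_map_poly coeff_mult)

lemma map_poly_of_int_pderiv:
  "map_poly of_int (pderiv p) = pderiv (map_poly of_int p :: 'a :: field_char_0 poly)"
  by (rule poly_eqI) (simp add: coeff_map_poly coeff_pderiv)

lemma map_poly_of_int_inject:
  "map_poly of_int p = (map_poly of_int q :: 'a :: field_char_0 poly) \<longleftrightarrow> p = q"
  by (auto simp: poly_eq_iff coeff_map_poly)

lemma map_poly_of_rat_of_int:
  "map_poly of_rat (map_poly of_int p) = (map_poly of_int p :: 'a :: field_char_0 poly)"
  by (rule poly_eqI) (simp add: coeff_map_poly)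

lemma degree_map_poly_of_int:
  "degree (map_poly of_int p :: 'a :: field_char_0 poly) = degree p"
  by (rule degree_map_poly) simp

lemma clear_denominators:
  fixes p :: "rat poly"
  obtains d P where "d > 0" "smult (of_int d) p = map_poly of_int P"
proof -
  have "\<exists>d P. d > 0 \<and> smult (of_int d) p = map_poly of_int P"
  proof (induction p)
    case 0
    show ?case by (rule exI[of _ 1], rule exI[of _ 0]) simp
  next
    case (pCons a p)
    then obtain d P where d: "d > 0" "smult (of_int d) p = map_poly of_int P" by blast
    obtain u v where uv: "quotient_of a = (u, v)" by force
    have v: "v > 0" "a = of_int u / of_int v"
      using quotient_of_denom_pos[OF uv] quotient_of_div[OF uv] by auto
    have "smult (of_int (v * d)) (pCons a p) = map_poly of_int (pCons (d * u) (smult v P))"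
      using v d by (simp add: map_poly_pCons map_poly_of_int_smult flip: d(2))
    moreover have "v * d > 0" using v d by simp
    ultimately show ?case by blast
  qed
  then show ?thesis using that by blast
qed

text \<open>Clear denominators, then divide by the content. As \<open>p\<close> is monic, the
  multiplier \<open>a\<close> is the leading coefficient of the primitive part.\<close>

lemma monic_primitive_multiple:
  fixes p :: "rat poly"
  assumes "lead_coeff p = 1"
  obtains a P where "a > 0" "content P = 1" "smult (of_int a) p = map_poly of_int P"
proof -
  obtain d Q where d: "d > 0" and Q: "smult (of_int d) p = map_poly of_int Q"
    by (rule clear_denominators)
  define P where "P = primitive_part Q"
  define c where "c = content Q"
  have QP: "Q = smult c P" by (simp add: P_def c_def)
  have "lead_coeff (smult (of_int d) p) = of_int d" using assms d by simp
  then have lQ: "lead_coeff Q = d"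
    by (simp add: Q degree_map_poly_of_int coeff_map_poly)
  then have Q0: "Q \<noteq> 0" using d by auto
  have c: "c > 0" using Q0 unfolding c_def by (metis content_eq_zero_iff normalize_content
    abs_ge_zero normalize_int_def order_le_less)
  define a where "a = lead_coeff P"
  have dca: "d = c * a" using lQ c unfolding QP a_def by simp
  have "a > 0" using d c unfolding dca by (simp add: zero_less_mult_iff)
  moreover have "content P = 1" using Q0 unfolding P_def by simp
  moreover have "smult (of_int c) (smult (of_int a) p) = smult (of_int c) (map_poly of_int P)"
    using Q unfolding QP dca by (simp add: map_poly_of_int_smult)
  then have "smult (of_int a) p = map_poly of_int P"
    using c by (metis less_irrefl of_int_0_eq_iff smult_cancel)
  ultimately show ?thesis by (rule that)
qed

text \<open>Gauss's lemma: \<open>P * Q\<close> is primitive as a product of primitive polynomials,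
  yet it is \<open>a * b\<close> times the integer polynomial \<open>R\<close>. So the positive
  integers \<open>a\<close> and \<open>b\<close> are both 1.\<close>

lemma monic_factors_integral:
  fixes p q :: "rat poly"
  assumes p: "lead_coeff p = 1" and q: "lead_coeff q = 1" and R: "p * q = map_poly of_int R"
  obtains P Q where "p = map_poly of_int P" "q = map_poly of_int Q"
proof -
  obtain a P where a: "a > 0" "content P = 1" "smult (of_int a) p = map_poly of_int P"
    by (rule monic_primitive_multiple[OF p])
  obtain b Q where b: "b > 0" "content Q = 1" "smult (of_int b) q = map_poly of_int Q"
    by (rule monic_primitive_multiple[OF q])
  have "map_poly of_int (smult (a * b) R) = (map_poly of_int (P * Q) :: rat poly)"
    by (simp add: map_poly_of_int_smult map_poly_of_int_mult flip: a(3) b(3) R) (simp add: mult.commute)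
  then have "smult (a * b) R = P * Q" by (simp only: map_poly_of_int_inject)
  then have "content (smult (a * b) R) = 1" using a b by (simp add: content_mult)
  then have "a * b dvd 1" by (metis content_smult dvd_triv_left normalize_dvd_iff)
  then have "a = 1" "b = 1" using a(1) b(1) by (auto simp: zmult_eq_1_iff)
  then show ?thesis using a b by (intro that[of P Q]) auto
qed

section \<open>Minimal polynomials\<close>

lemma is_min_poly_rat_dvd:
  assumes p: "is_min_poly_rat x p" and q: "poly (map_poly of_rat q) x = 0"
  shows "p dvd q"
proof -
  have p0: "p \<noteq> 0" using p by (auto simp: is_min_poly_rat_def)
  have "q mod p = q - p * (q div p)" by (simp add: minus_mult_div_eq_mod)
  then have "poly (map_poly of_rat (q mod p)) x = 0"
    using p q by (simp add: map_poly_of_rat_diff map_poly_of_rat_mult is_min_poly_rat_def)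
  then have "q mod p = 0"
    using p degree_mod_less[OF p0, of q] unfolding is_min_poly_rat_def by (meson leD)
  then show ?thesis by auto
qed

lemma is_min_poly_rat_degree_pos:
  assumes "is_min_poly_rat x p"
  shows "degree p > 0"
proof (rule ccontr)
  assume "\<not> degree p > 0"
  then have "p = [:1:]"
    using assms unfolding is_min_poly_rat_def by (metis degree_eq_zeroE gr0I lead_coeff_pCons(2) pCons_0_0 coeff_pCons_0)
  then show False using assms by (simp add: is_min_poly_rat_def map_poly_pCons)
qed

text \<open>Irreducibility in disguise: write \<open>p = ?r * h\<close> with \<open>?r\<close>
  minimal for \<open>y\<close>. Then \<open>x\<close> is a root of \<open>?r\<close> or of
  \<open>h\<close>. The degree of \<open>h\<close> is too small for that, so \<open>x\<close> is a
  root of \<open>?r\<close>, which must have the full degree of \<open>p\<close>.\<close>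

lemma is_min_poly_rat_conjugate:
  assumes p: "is_min_poly_rat x p" and y: "poly (map_poly of_rat p) y = 0"
  shows "is_min_poly_rat y p"
proof -
  have p0: "p \<noteq> 0" using p by (auto simp: is_min_poly_rat_def)
  let ?r = "min_poly_rat y"
  have r: "is_min_poly_rat y ?r" by (rule is_min_poly_rat_min_poly_rat[OF p0 y])
  obtain h where h: "p = ?r * h" using is_min_poly_rat_dvd[OF r y] by (elim dvdE)
  have nz: "?r \<noteq> 0" "h \<noteq> 0" using h p0 by auto
  have "poly (map_poly of_rat ?r) x * poly (map_poly of_rat h) x = 0"
    using p by (subst (asm) h) (simp add: is_min_poly_rat_def map_poly_of_rat_mult)
  moreover have "degree p = degree ?r + degree h" using nz by (subst h) (rule degree_mult_eq)
  ultimately have "degree p \<le> degree ?r"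
    using p nz is_min_poly_rat_degree_pos[OF r] unfolding is_min_poly_rat_def
    by (metis add.commute add_le_same_cancel1 leD mult_eq_0_iff)
  then show ?thesis using p r y unfolding is_min_poly_rat_def by (meson order_trans)
qed

section \<open>Congruences in the ring generated by a real number\<close>

text \<open>This is the ring \<int>[a], realised inside the reals as the values of integer
  polynomials at \<open>a\<close>.\<close>

definition int_adj :: "real \<Rightarrow> real set" where
  "int_adj a = range (\<lambda>p. ipoly p a)"

lemma int_adj_of_int [simp]: "of_int c \<in> int_adj a"
  unfolding int_adj_def by (rule image_eqI[of _ _ "[:c:]"]) (simp_all add: map_poly_pCons)

lemma int_adj_numeral [simp]: "0 \<in> int_adj a" "1 \<in> int_adj a" "numeral k \<in> int_adj a"
  "of_nat n \<in> int_adj a"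
  using int_adj_of_int[of 0 a] int_adj_of_int[of 1 a] int_adj_of_int[of "numeral k" a]
    int_adj_of_int[of "int n" a]
  by simp_all

lemma int_adj_generator [simp]: "a \<in> int_adj a"
  unfolding int_adj_def by (rule image_eqI[of _ _ "[:0, 1:]"]) (simp_all add: map_poly_pCons)

lemma int_adj_add [simp]: "x \<in> int_adj a \<Longrightarrow> y \<in> int_adj a \<Longrightarrow> x + y \<in> int_adj a"
  unfolding int_adj_def by (auto simp flip: poly_add map_poly_of_int_add)

lemma int_adj_diff [simp]: "x \<in> int_adj a \<Longrightarrow> y \<in> int_adj a \<Longrightarrow> x - y \<in> int_adj a"
  unfolding int_adj_def by (auto simp flip: poly_diff map_poly_of_int_diff)

lemma int_adj_mult [simp]: "x \<in> int_adj a \<Longrightarrow> y \<in> int_adj a \<Longrightarrow> x * y \<in> int_adj a"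
  unfolding int_adj_def by (auto simp flip: poly_mult map_poly_of_int_mult)

lemma int_adj_power [simp]: "x \<in> int_adj a \<Longrightarrow> x ^ n \<in> int_adj a"
  by (induction n) simp_all

lemma int_adj_sum: "(\<And>i. i \<in> S \<Longrightarrow> f i \<in> int_adj a) \<Longrightarrow> sum f S \<in> int_adj a"
  by (induction S rule: infinite_finite_induct) simp_all

lemma int_adj_ipoly [simp]: "x \<in> int_adj a \<Longrightarrow> ipoly p x \<in> int_adj a"
  by (induction p) (simp_all add: map_poly_pCons)

text \<open>Congruence modulo the ideal generated by \<open>q\<close> in \<int>[a]. Only the
  difference is constrained; \<open>x\<close> and \<open>y\<close> may lie outside the ring, hence
  the membership hypotheses of \<open>adj_cong_mult\<close>.\<close>

definition adj_cong :: "real \<Rightarrow> nat \<Rightarrow> real \<Rightarrow> real \<Rightarrow> bool" where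
  "adj_cong a q x y \<longleftrightarrow> (\<exists>z \<in> int_adj a. x - y = of_nat q * z)"

lemma adj_cong_refl [simp]: "adj_cong a q x x"
  by (auto simp: adj_cong_def intro!: bexI[of _ 0])

lemma adj_cong_sym: "adj_cong a q x y \<Longrightarrow> adj_cong a q y x"
  unfolding adj_cong_def
proof (elim bexE)
  fix z assume "z \<in> int_adj a" "x - y = of_nat q * z"
  then show "\<exists>z\<in>int_adj a. y - x = of_nat q * z"
    using int_adj_diff[of 0 a z] by (intro bexI[of _ "0 - z"]) (auto simp: algebra_simps)
qed

lemma adj_cong_trans [trans]: "adj_cong a q x y \<Longrightarrow> adj_cong a q y z \<Longrightarrow> adj_cong a q x z"
  unfolding adj_cong_def
proof (elim bexE)
  fix u v assume "u \<in> int_adj a" "x - y = of_nat q * u" "v \<in> int_adj a" "y - z = of_nat q * v"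
  then show "\<exists>w\<in>int_adj a. x - z = of_nat q * w"
    by (intro bexI[of _ "u + v"]) (auto simp: algebra_simps)
qed

lemma adj_cong_add:
  "adj_cong a q x y \<Longrightarrow> adj_cong a q x' y' \<Longrightarrow> adj_cong a q (x + x') (y + y')"
  unfolding adj_cong_def
proof (elim bexE)
  fix u v assume "u \<in> int_adj a" "x - y = of_nat q * u" "v \<in> int_adj a" "x' - y' = of_nat q * v"
  then show "\<exists>w\<in>int_adj a. x + x' - (y + y') = of_nat q * w"
    by (intro bexI[of _ "u + v"]) (auto simp: algebra_simps)
qed

lemma adj_cong_mult:
  assumes "adj_cong a q x y" "adj_cong a q x' y'" "x' \<in> int_adj a" "y \<in> int_adj a"
  shows "adj_cong a q (x * x') (y * y')"
proof -
  obtain u where u: "u \<in> int_adj a" "x - y = of_nat q * u"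
    using assms by (auto simp: adj_cong_def)
  obtain v where v: "v \<in> int_adj a" "x' - y' = of_nat q * v"
    using assms by (auto simp: adj_cong_def)
  have "x * x' - y * y' = (x - y) * x' + y * (x' - y')" by (simp add: algebra_simps)
  also have "\<dots> = of_nat q * (u * x' + y * v)" unfolding u v by (simp add: algebra_simps)
  finally show ?thesis using assms u v by (auto simp: adj_cong_def)
qed

text \<open>The inner binomial coefficients are divisible by the prime \<open>q\<close>, so only the
  two end terms survive.\<close>

lemma adj_cong_power_add:
  assumes q: "prime q" and "x \<in> int_adj a" "y \<in> int_adj a"
  shows "adj_cong a q ((x + y) ^ q) (x ^ q + y ^ q)"
proof -
  have q2: "q \<ge> 2" using q by (rule prime_ge_2_nat)
  let ?t = "\<lambda>k. of_nat (q choose k) * x ^ k * y ^ (q - k)"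
  have "{..q} = insert 0 (insert q {0<..<q})" using q2 by auto
  then have "(x + y) ^ q = ?t 0 + (?t q + sum ?t {0<..<q})"
    using q2 by (simp add: binomial_ring)
  also have "sum ?t {0<..<q} = (\<Sum>k\<in>{0<..<q}. of_nat q * (of_nat ((q choose k) div q) * x ^ k * y ^ (q - k)))"
  proof (rule sum.cong)
    fix k assume "k \<in> {0<..<q}"
    then have "q dvd q choose k" using q q2 by (intro dvd_choose_prime) auto
    then have "real (q choose k) = real q * real ((q choose k) div q)"
      by (metis dvd_mult_div_cancel of_nat_mult)
    then show "?t k = of_nat q * (of_nat ((q choose k) div q) * x ^ k * y ^ (q - k))" by simp
  qed simp
  finally have "(x + y) ^ q - (x ^ q + y ^ q) =
      of_nat q * (\<Sum>k\<in>{0<..<q}. of_nat ((q choose k) div q) * x ^ k * y ^ (q - k))"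
    by (simp add: sum_distrib_left)
  moreover have "(\<Sum>k\<in>{0<..<q}. of_nat ((q choose k) div q) * x ^ k * y ^ (q - k)) \<in> int_adj a"
    using assms by (intro int_adj_sum) simp
  ultimately show ?thesis by (auto simp: adj_cong_def)
qed

text \<open>Additivity of the \<open>q\<close>-th power, with second summand 1, drives the induction
  both ways. Downwards it is applied to \<open>(c - 1) + 1\<close>, which avoids powers of -1 and
  treats \<open>q = 2\<close> like the odd primes.\<close>

lemma adj_cong_fermat:
  assumes q: "prime q"
  shows "adj_cong a q (of_int c ^ q) (of_int c)"
proof (induction c rule: int_induct[of _ 0])
  case base
  show ?case using prime_gt_0_nat[OF q] by (simp add: zero_power)
next
  case (step1 c)
  have "adj_cong a q ((of_int c + 1) ^ q) (of_int c ^ q + 1 ^ q)"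
    using q by (intro adj_cong_power_add) simp_all
  also have "adj_cong a q \<dots> (of_int c + 1)"
    using step1 by (intro adj_cong_add) simp_all
  finally show ?case by simp
next
  case (step2 c)
  have "adj_cong a q ((of_int (c - 1) + 1) ^ q) (of_int (c - 1) ^ q + 1 ^ q)"
    using q by (intro adj_cong_power_add int_adj_of_int int_adj_numeral)
  then have "adj_cong a q (of_int c ^ q) (of_int (c - 1) ^ q + 1)" by simp
  then have "adj_cong a q (of_int (c - 1) ^ q + 1) (of_int c)"
    using step2 by (blast intro: adj_cong_sym adj_cong_trans)
  then have "adj_cong a q (of_int (c - 1) ^ q + 1 + - 1) (of_int c + - 1)"
    by (intro adj_cong_add) simp_all
  then show ?case by simp
qed

text \<open>Modulo \<open>q\<close>, raising to the power \<open>q\<close> respects sums and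
  products and fixes the integers, so it commutes with evaluating integer polynomials.\<close>

lemma adj_cong_ipoly_frobenius:
  assumes q: "prime q" and x: "x \<in> int_adj a" and y: "y \<in> int_adj a"
    and yx: "adj_cong a q y (x ^ q)"
  shows "adj_cong a q (ipoly p y) (ipoly p x ^ q)"
proof (induction p)
  case 0
  show ?case using prime_gt_0_nat[OF q] by (simp add: zero_power)
next
  case (pCons c p)
  have c: "adj_cong a q (of_int c) (of_int c ^ q)"
    using adj_cong_fermat[OF q] by (rule adj_cong_sym)
  have "adj_cong a q (y * ipoly p y) (x ^ q * ipoly p x ^ q)"
    using yx pCons.IH x y by (intro adj_cong_mult) simp_all
  then have "adj_cong a q (of_int c + y * ipoly p y) (of_int c ^ q + (x * ipoly p x) ^ q)"
    using c by (intro adj_cong_add) (simp_all add: power_mult_distrib)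
  also have "adj_cong a q \<dots> ((of_int c + x * ipoly p x) ^ q)"
    using q x by (intro adj_cong_sym[OF adj_cong_power_add]) simp_all
  finally show ?case by (simp add: map_poly_pCons)
qed

text \<open>As \<open>F\<close> is monic, integral and minimal for \<open>a\<close>, the powers of
  \<open>a\<close> below its degree form a basis of \<int>[a] over the integers. The basis contains
  1, so an integer divisible by \<open>q\<close> in \<int>[a] is divisible by \<open>q\<close> among
  the integers.\<close>

lemma adj_cong_of_int_0_imp_dvd:
  assumes F: "is_min_poly_rat a (map_poly of_int F)" and c: "adj_cong a q (of_int c) 0"
  shows "int q dvd c"
proof -
  obtain z where "z \<in> int_adj a" and z: "of_int c = of_nat q * z"
    using c by (auto simp: adj_cong_def)
  then obtain P where P: "z = ipoly P a" by (auto simp: int_adj_def)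
  have lF: "lead_coeff F = 1"
    using F by (simp add: is_min_poly_rat_def degree_map_poly_of_int coeff_map_poly)
  then have F0: "F \<noteq> 0" by auto
  \<comment> \<open>Because \<open>F\<close> is monic, the scaling factor of pseudo-division is 1
    and this is genuine division over the integers.\<close>
  obtain s r where sr: "pseudo_divmod P F = (s, r)" by force
  have P': "P = F * s + r" and r: "r = 0 \<or> degree r < degree F"
    using pseudo_divmod[OF F0 sr] lF by simp_all
  have Fa: "ipoly F a = 0" using F by (simp add: is_min_poly_rat_def map_poly_of_rat_of_int)
  have dF: "degree F > 0"
    using is_min_poly_rat_degree_pos[OF F] by (simp add: degree_map_poly_of_int)
  \<comment> \<open>A relation for \<open>a\<close> of degree below that of \<open>F\<close>
    vanishes identically; its constant coefficient then exhibits \<open>c\<close> as a multiple of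
    \<open>q\<close>.\<close>
  let ?h = "smult (int q) r - [:c:]"
  have "ipoly ?h a = 0"
    using z P Fa unfolding P'
    by (simp add: map_poly_of_int_add map_poly_of_int_mult map_poly_of_int_diff
        map_poly_of_int_smult map_poly_pCons)
  moreover have "degree ?h < degree F"
    using r dF by (intro degree_diff_less) (auto simp: degree_smult_le le_less_trans)
  ultimately have "(map_poly of_int ?h :: rat poly) = 0"
    using F unfolding is_min_poly_rat_def
    by (metis degree_map_poly_of_int leD map_poly_of_rat_of_int)
  then have "?h = 0" by (metis map_poly_of_int_inject map_poly_0)
  then have "coeff ?h 0 = 0" by simp
  then show ?thesis by (simp add: dvd_def) (metis)
qed

section \<open>The polynomials \<open>t_hat n\<close>\<close>

text \<open>Substituting x/2 absorbs the factor 2 of the Chebyshev recurrence. This is the source of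
  the integral coefficients and of the leading coefficient 1.\<close>

lemma t_hat_rec: "t_hat (Suc (Suc n)) = pCons 0 (t_hat (Suc n)) - t_hat n"
  by (simp add: t_hat_def pcompose_diff pcompose_mult pcompose_pCons pcompose_smult smult_diff_right)

lemma t_hat_0 [simp]: "t_hat 0 = [:2:]" and t_hat_1 [simp]: "t_hat (Suc 0) = [:0, 1:]"
  by (simp_all add: t_hat_def pcompose_pCons one_pCons)

lemma t_hat_integral:
  obtains T where "(t_hat n :: 'a :: field_char_0 poly) = map_poly of_int T"
proof -
  have "\<exists>T. (t_hat n :: 'a poly) = map_poly of_int T"
  proof (induction n rule: cheb_T.induct)
    case 1 show ?case by (intro exI[of _ "[:2:]"]) (simp add: map_poly_pCons)
  next
    case 2 show ?case by (intro exI[of _ "[:0,1:]"]) (simp add: map_poly_pCons)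
  next
    case (3 n)
    then obtain P Q :: "int poly" where
      "(t_hat (Suc n) :: 'a poly) = map_poly of_int P" "(t_hat n :: 'a poly) = map_poly of_int Q"
      by blast
    then show ?case
      by (intro exI[of _ "pCons 0 P - Q"])
        (simp add: t_hat_rec map_poly_of_int_diff map_poly_pCons)
  qed
  then show ?thesis using that by blast
qed

lemma map_poly_of_rat_t_hat: "map_poly of_rat (t_hat n) = (t_hat n :: 'a :: field_char_0 poly)"
  by (subst poly_eq_poly_eq_iff[symmetric]) (simp add: fun_eq_iff poly_map_poly_t_hat)

lemma monic_t_hat:
  assumes "n \<ge> 1"
  shows "degree (t_hat n :: 'a :: field_char_0 poly) = n" "lead_coeff (t_hat n :: 'a poly) = 1"
proof -
  \<comment> \<open>The index 0 is exempt from the first conjunct because \<open>t_hat 0\<close> is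
    the constant 2.\<close>
  have *: "(n \<ge> 1 \<longrightarrow> coeff (t_hat n :: 'a poly) n = 1) \<and> (\<forall>i>n. coeff (t_hat n :: 'a poly) i = 0)"
    for n
  proof (induction n rule: cheb_T.induct)
    case (3 n)
    then show ?case by (auto simp: t_hat_rec coeff_pCons split: nat.splits)
  qed (auto simp: coeff_pCons split: nat.splits)
  have "degree (t_hat n :: 'a poly) \<le> n" using *[of n] by (intro degree_le) auto
  moreover have "n \<le> degree (t_hat n :: 'a poly)" using *[of n] assms by (intro le_degree) auto
  ultimately show "degree (t_hat n :: 'a poly) = n" by simp
  then show "lead_coeff (t_hat n :: 'a poly) = 1" using *[of n] assms by simp
qed

text \<open>The cosine is even, so this is the value of the integral polynomial \<open>t_hat\<close>
  of index \<bar>i\<bar> at \<open>2 * cos t\<close>.\<close>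

lemma two_cos_in_int_adj: "2 * cos (of_int i * t) \<in> int_adj (2 * cos t)"
proof -
  obtain T where T: "(t_hat (nat \<bar>i\<bar>) :: real poly) = map_poly of_int T"
    by (rule t_hat_integral)
  have "ipoly T (2 * cos t) = 2 * cos (real_of_int \<bar>i\<bar> * t)"
    by (simp flip: T add: poly_t_hat_cos)
  also have "\<dots> = 2 * cos (of_int i * t)" by (cases "i \<ge> 0") auto
  finally show ?thesis by (metis int_adj_generator int_adj_ipoly)
qed

text \<open>Differentiate the identity \<open>poly_t_hat_cos\<close> with respect to
  \<open>t\<close> on both sides.\<close>

lemma poly_pderiv_t_hat_cos:
  "poly (pderiv (t_hat n)) (2 * cos t) * sin t = real n * sin (real n * t)"
proof -
  have "((\<lambda>t. poly (t_hat n) (2 * cos t)) has_real_derivative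
      poly (pderiv (t_hat n)) (2 * cos t) * (- 2 * sin t)) (at t)"
    by (rule DERIV_chain2[OF poly_DERIV]) (auto intro!: derivative_eq_intros)
  moreover have "((\<lambda>t. poly (t_hat n) (2 * cos t)) has_real_derivative
      - 2 * (real n * sin (real n * t))) (at t)"
    unfolding poly_t_hat_cos by (auto intro!: derivative_eq_intros)
  ultimately have "poly (pderiv (t_hat n)) (2 * cos t) * (- 2 * sin t)
      = - 2 * (real n * sin (real n * t))"
    by (rule DERIV_unique)
  then show ?thesis by simp
qed

text \<open>Write the double cosine as a sum of two conjugate exponentials, expand by the binomial
  theorem and take real parts.\<close>

lemma power_two_cos:
  fixes t :: real
  shows "(2 * cos t) ^ n = (\<Sum>k\<le>n. of_nat (n choose k) * cos (of_int (2 * int k - int n) * t))"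
proof -
  have "cis t + cis (- t) = complex_of_real (2 * cos t)"
    by (simp add: complex_eq_iff)
  then have "complex_of_real ((2 * cos t) ^ n) = (cis t + cis (- t)) ^ n" by simp
  also have "\<dots> = (\<Sum>k\<le>n. of_nat (n choose k) * cis t ^ k * cis (- t) ^ (n - k))"
    by (rule binomial_ring)
  also have "\<dots> = (\<Sum>k\<le>n. of_nat (n choose k) * cis (of_int (2 * int k - int n) * t))"
  proof (intro sum.cong refl)
    fix k assume "k \<in> {..n}"
    then have "cis t ^ k * cis (- t) ^ (n - k) = cis (of_int (2 * int k - int n) * t)"
      by (simp add: DeMoivre cis_mult of_nat_diff algebra_simps)
    then show "of_nat (n choose k) * cis t ^ k * cis (- t) ^ (n - k) =
        of_nat (n choose k) * cis (of_int (2 * int k - int n) * t)"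
      by (simp add: mult.assoc)
  qed
  finally have "Re (complex_of_real ((2 * cos t) ^ n)) =
      Re (\<Sum>k\<le>n. of_nat (n choose k) * cis (of_int (2 * int k - int n) * t))"
    by (rule arg_cong)
  then show ?thesis by (simp only: Re_complex_of_real) simp
qed

text \<open>In the expansion of the \<open>q\<close>-th power the end terms add up to
  \<open>2 * cos (real q * t)\<close>, and all other terms have a coefficient divisible by
  \<open>q\<close>.\<close>

lemma adj_cong_two_cos_prime:
  assumes q: "prime q" "odd q"
  shows "adj_cong (2 * cos t) q (2 * cos (real q * t)) ((2 * cos t) ^ q)"
proof -
  let ?a = "2 * cos t"
  let ?c = "\<lambda>k. cos (of_int (2 * int k - int q) * t)"
  have q2: "q \<ge> 2" using q(1) by (rule prime_ge_2_nat)
  have "{..q} = insert 0 (insert q {0<..<q})" using q2 by auto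
  then have "?a ^ q = 2 * cos (real q * t) + (\<Sum>k\<in>{0<..<q}. of_nat (q choose k) * ?c k)"
    using q2 unfolding power_two_cos by simp
  \<comment> \<open>Only the doubled cosines are known to lie in \<int>[a]. Hence the factor 2,
    which the oddness of \<open>q\<close> removes at the end.\<close>
  moreover have "2 * (\<Sum>k\<in>{0<..<q}. of_nat (q choose k) * ?c k) =
      of_nat q * (\<Sum>k\<in>{0<..<q}. of_nat ((q choose k) div q) * (2 * ?c k))"
    unfolding sum_distrib_left
  proof (rule sum.cong)
    fix k assume "k \<in> {0<..<q}"
    then have "q dvd q choose k" using q q2 by (intro dvd_choose_prime) auto
    then have "real (q choose k) = real q * real ((q choose k) div q)"
      by (metis dvd_mult_div_cancel of_nat_mult)
    then show "2 * (of_nat (q choose k) * ?c k) =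
        of_nat q * (of_nat ((q choose k) div q) * (2 * ?c k))" by simp
  qed simp
  moreover define z where "z = (\<Sum>k\<in>{0<..<q}. of_nat ((q choose k) div q) * (2 * ?c k))"
  ultimately have z: "2 * (2 * cos (real q * t) - ?a ^ q) = - of_nat q * z"
    by (simp add: algebra_simps)
  have zA: "z \<in> int_adj ?a"
    unfolding z_def by (intro int_adj_sum int_adj_mult int_adj_numeral two_cos_in_int_adj)
  define d where "d = 2 * cos (real q * t) - ?a ^ q"
  have dA: "d \<in> int_adj ?a"
    unfolding d_def using two_cos_in_int_adj[of "int q" t]
    by (intro int_adj_diff int_adj_power int_adj_generator) simp
  obtain r where r: "q = 2 * r + 1" using q(2) by (elim oddE)
  \<comment> \<open>2 is invertible modulo \<open>q\<close>, with inverse \<open>r + 1\<close>.\<close>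
  have "d = of_nat (r + 1) * (2 * d) - of_nat q * d" unfolding r by (simp add: algebra_simps)
  also have "\<dots> = of_nat q * (0 - of_nat (r + 1) * z - d)"
    unfolding z[folded d_def] by (simp add: algebra_simps)
  finally have "d = of_nat q * (0 - of_nat (r + 1) * z - d)" .
  moreover have "0 - of_nat (r + 1) * z - d \<in> int_adj ?a"
    using zA dA by (intro int_adj_diff int_adj_mult int_adj_numeral)
  ultimately show ?thesis unfolding adj_cong_def d_def by blast
qed

section \<open>Conjugates of \<open>2 cos (pi / N)\<close>\<close>

lemma min_poly_two_cos_prime_multiple:
  assumes f: "is_min_poly_rat (2 * cos t) f" and ct: "cos (real n * t) = 0"
    and q: "prime q" "odd q" "\<not> q dvd n"
  shows "poly (map_poly of_rat f) (2 * cos (real q * t)) = 0"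
proof (rule ccontr)
  assume nz: "poly (map_poly of_rat f) (2 * cos (real q * t)) \<noteq> 0"
  define a where "a = 2 * cos t"
  define c where "c = 2 * cos (real q * t)"
  have n: "n \<ge> 1" using ct by (cases n) auto
  obtain T where T: "(t_hat n :: rat poly) = map_poly of_int T" by (rule t_hat_integral)
  have lf: "lead_coeff f = 1" using f by (simp add: is_min_poly_rat_def)
  have "f dvd t_hat n"
    by (rule is_min_poly_rat_dvd[OF f]) (simp only: poly_map_poly_t_hat poly_t_hat_cos ct mult_zero_right)
  then obtain g where g: "t_hat n = f * g" by (elim dvdE)
  have lg: "lead_coeff g = 1"
    using monic_t_hat(2)[OF n, where 'a = rat] lf unfolding g by (simp add: lead_coeff_mult)
  \<comment> \<open>Gauss's lemma puts both factors over the integers, where congruences modulo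
    \<open>q\<close> apply.\<close>
  obtain F G where F: "f = map_poly of_int F" and G: "g = map_poly of_int G"
    using monic_factors_integral[OF lf lg] g T by metis
  have tr: "(t_hat n :: real poly) = map_poly of_int F * map_poly of_int G"
    using map_poly_of_rat_t_hat[of n, where 'a = real] unfolding g F G
    by (simp add: map_poly_of_rat_mult map_poly_of_rat_of_int)
  \<comment> \<open>An odd multiple of pi/2 stays one after multiplication by the odd number
    \<open>q\<close>, so \<open>c\<close> is again a root of \<open>t_hat n\<close>.\<close>
  obtain i where i: "odd i" "real n * t = of_int i * (pi / 2)"
    using ct unfolding cos_zero_iff_int by blast
  have "real n * (real q * t) = of_int (int q * i) * (pi / 2)"
    using i(2) by (simp add: algebra_simps)
  moreover have "odd (int q * i)" using i q by simp
  ultimately have cq: "cos (real n * (real q * t)) = 0" unfolding cos_zero_iff_int by blast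
  have "poly (t_hat n) c = 0" unfolding c_def using cq by (simp add: poly_t_hat_cos)
  moreover have "ipoly F c \<noteq> 0" using nz by (simp add: c_def F map_poly_of_rat_of_int)
  ultimately have Gc: "ipoly G c = 0" by (simp add: tr)
  have cA: "c \<in> int_adj a"
    unfolding c_def a_def using two_cos_in_int_adj[of "int q" t] by simp
  have fa: "ipoly F a = 0"
    using f by (simp add: is_min_poly_rat_def F map_poly_of_rat_of_int a_def)
  have "adj_cong a q (ipoly F c) (ipoly F a ^ q)"
    using q(1) cA adj_cong_two_cos_prime[OF q(1,2), of t]
    by (intro adj_cong_ipoly_frobenius) (simp_all only: a_def c_def int_adj_generator)
  then have Fc: "adj_cong a q (ipoly F c) 0"
    using fa prime_gt_0_nat[OF q(1)] by (simp add: zero_power)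
  define w where "w = ipoly (pderiv G) c"
  have w: "w \<in> int_adj a" using cA by (simp add: w_def)
  have D: "poly (pderiv (t_hat n)) c = ipoly F c * w"
    unfolding tr by (simp add: pderiv_mult Gc w_def map_poly_of_int_pderiv)
  have s: "sin (real n * (real q * t)) ^ 2 = 1"
    using cq sin_cos_squared_add[of "real n * (real q * t)"] by simp
  \<comment> \<open>Squaring the derivative formula eliminates both sines: one square is 1, the
    other is expressed by \<open>c\<close>. Thus 4n^2 becomes \<open>ipoly F c\<close> times an
    element of \<int>[a].\<close>
  have "(2 * real n) ^ 2 = (2 * (real n * sin (real n * (real q * t)))) ^ 2"
    using s by (simp add: power_mult_distrib)
  also have "\<dots> = (ipoly F c * w) ^ 2 * (4 * sin (real q * t) ^ 2)"
    unfolding poly_pderiv_t_hat_cos[symmetric] c_def[symmetric] D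
    by (simp add: power_mult_distrib)
  also have "4 * sin (real q * t) ^ 2 = 4 - c ^ 2"
    by (simp add: c_def sin_squared_eq power_mult_distrib)
  finally have "of_int ((2 * int n) ^ 2) = ipoly F c * (ipoly F c * w ^ 2 * (4 - c ^ 2))"
    by (simp add: power2_eq_square)
  moreover have "adj_cong a q \<dots> (0 * (ipoly F c * w ^ 2 * (4 - c ^ 2)))"
    using Fc w cA by (intro adj_cong_mult) simp_all
  ultimately have "adj_cong a q (of_int ((2 * int n) ^ 2)) 0" by (simp only: mult_zero_left)
  then have "int q dvd (2 * int n) ^ 2"
    using f unfolding a_def F by (rule adj_cong_of_int_0_imp_dvd[rotated])
  then have "int q dvd int ((2 * n) ^ 2)" by simp
  then have "q dvd (2 * n) ^ 2" by (simp only: int_dvd_int_iff)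
  then have "q dvd 2 * n" using q(1) by (rule prime_dvd_power[rotated])
  then have "q dvd 2" using q by (auto simp: prime_dvd_mult_iff)
  then show False using q by (metis primes_dvd_imp_eq two_is_prime_nat even_numeral)
qed

text \<open>Each prime factor of \<open>j\<close> multiplies the angle in turn. The root reached so
  far has \<open>C_poly N\<close> as its minimal polynomial too, so the preceding lemma applies
  again with \<open>n\<close> half of \<open>N\<close>; evenness of \<open>N\<close> makes all these
  primes odd.\<close>

lemma C_poly_root_coprime:
  assumes N: "N > 0" "even N" and j: "coprime j N"
  shows "poly (map_poly of_rat (C_poly N)) (2 * cos (real j * pi / real N)) = 0"
  using j
proof (induction j rule: prime_divisors_induct)
  case zero
  then show ?case using N by simp
next
  case (unit x)
  then show ?case
    using is_min_poly_rat_C_poly[of N] N by (simp add: is_min_poly_rat_def)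
next
  case (factor p x)
  have cp: "coprime p N" "coprime x N" using factor.prems by auto
  obtain n where n: "N = 2 * n" using N by (elim evenE)
  have "odd x" "odd p" "coprime p n" using cp by (auto simp: n)
  have "\<not> p dvd n"
    using \<open>coprime p n\<close> \<open>prime p\<close> coprime_common_divisor_nat[of p n p] by auto
  have "is_min_poly_rat (2 * cos (real x * pi / real N)) (C_poly N)"
    using N by (intro is_min_poly_rat_conjugate[OF is_min_poly_rat_C_poly factor.IH[OF cp(2)]]) simp
  moreover have "cos (real n * (real x * pi / real N)) = 0"
    unfolding cos_zero_iff_int using N \<open>odd x\<close> by (intro exI[of _ "int x"]) (simp add: n)
  ultimately have "poly (map_poly of_rat (C_poly N)) (2 * cos (real p * (real x * pi / real N))) = 0"
    using \<open>prime p\<close> \<open>odd p\<close> \<open>\<not> p dvd n\<close> by (rule min_poly_two_cos_prime_multiple)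
  then show ?case by (simp add: mult.assoc)
qed

text \<open>A common root would make \<open>C_poly N\<close> and \<open>C_poly M\<close> equal, so
  \<open>N < M\<close> may be assumed. Then \<open>C_poly N\<close> divides \<open>t_hat\<close> of
  index N/2, whose value at \<open>2 * cos (pi / real M)\<close> is twice the cosine of an angle in
  [0, pi/2), hence positive.\<close>

lemma C_poly_nonroot:
  assumes N: "N > 0" "even N" and M: "M > 0" "even M" and "N \<noteq> M"
  shows "poly (map_poly of_rat (C_poly N)) (2 * cos (pi / real M)) \<noteq> 0"
proof -
  have less: "poly (map_poly of_rat (C_poly N)) (2 * cos (pi / real M)) \<noteq> 0"
    if N: "N > 0" "even N" and "N < M" for N M
  proof
    assume root: "poly (map_poly of_rat (C_poly N)) (2 * cos (pi / real M)) = 0"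
    obtain n where n: "N = 2 * n" using N by (elim evenE)
    have "cos (real n * (pi / real N)) = 0" using N by (simp add: n)
    then have "C_poly N dvd t_hat n"
      using N by (intro is_min_poly_rat_dvd[OF is_min_poly_rat_C_poly])
        (simp_all add: poly_map_poly_t_hat poly_t_hat_cos)
    then obtain h where h: "t_hat n = C_poly N * h" by (elim dvdE)
    have "poly (map_poly of_rat (t_hat n)) (2 * cos (pi / real M)) = 0"
      using root unfolding h by (simp add: map_poly_of_rat_mult)
    then have "cos (real n * (pi / real M)) = 0"
      by (simp add: poly_map_poly_t_hat poly_t_hat_cos)
    moreover have "cos (real n * (pi / real M)) > 0"
    proof (rule cos_gt_zero_pi)
      have "2 * real n < real M" using \<open>N < M\<close> unfolding n by linarith
      then have "2 * real n * pi < real M * pi" by simp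
      then show "real n * (pi / real M) < pi / 2" using \<open>N < M\<close> by (simp add: field_simps)
      have "0 \<le> real n * (pi / real M)" by simp
      then show "- (pi / 2) < real n * (pi / real M)" using pi_gt_zero by linarith
    qed
    ultimately show False by simp
  qed
  show ?thesis
  proof (cases "N < M")
    case True
    then show ?thesis using less N by blast
  next
    case False
    show ?thesis
    proof
      assume "poly (map_poly of_rat (C_poly N)) (2 * cos (pi / real M)) = 0"
      then have "is_min_poly_rat (2 * cos (pi / real M)) (C_poly N)"
        using N is_min_poly_rat_conjugate[OF is_min_poly_rat_C_poly[of N]] by simp
      then have "C_poly N = C_poly M"
        using M is_min_poly_rat_C_poly[of M] is_min_poly_rat_unique by simp
      moreover have "poly (map_poly of_rat (C_poly N)) (2 * cos (pi / real N)) = 0"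
        using N is_min_poly_rat_C_poly[of N] by (simp add: is_min_poly_rat_def)
      ultimately show False using less[of M N] M False \<open>N \<noteq> M\<close> by simp
    qed
  qed
qed

section \<open>The factorisation of \<open>t_hat n\<close>\<close>

lemma poly_map_poly_of_rat_prod:
  "poly (map_poly of_rat (\<Prod>i\<in>S. f i)) (x :: 'a :: field_char_0) =
     (\<Prod>i\<in>S. poly (map_poly of_rat (f i)) x)"
  by (induction S rule: infinite_finite_induct) (simp_all add: map_poly_of_rat_mult)

text \<open>Factors are split off one at a time: the defining root of the new \<open>C_poly\<close>
  is a root of \<open>t_hat n\<close> but of none of the earlier factors, so it is a root of the
  remaining cofactor.\<close>

lemma prod_C_poly_dvd_t_hat:
  assumes n: "n = 2 ^ k * m" "n \<ge> 1" "odd m" and S: "S \<subseteq> {d. d dvd m}"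
  shows "(\<Prod>d\<in>S. C_poly (2 ^ (k + 1) * d)) dvd t_hat n"
proof -
  have m: "m > 0" using n by auto
  have "finite S" using S m by (metis finite_divisors_nat finite_subset)
  then show ?thesis using S
  proof (induction S)
    case (insert d S)
    let ?C = "\<lambda>d. C_poly (2 ^ (k + 1) * d)"
    let ?x = "2 * cos (pi / real (2 ^ (k + 1) * d))"
    obtain g where g: "t_hat n = prod ?C S * g" using insert by (auto elim: dvdE)
    obtain e where e: "m = d * e" using insert by (auto elim: dvdE)
    have "odd e" "d > 0" using n m e by auto
    then have "cos (real n * (pi / real (2 ^ (k + 1) * d))) = 0"
      unfolding cos_zero_iff_int n(1) e by (intro exI[of _ "int e"]) (simp add: field_simps)
    then have "poly (map_poly of_rat (t_hat n)) ?x = 0"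
      by (simp only: poly_map_poly_t_hat poly_t_hat_cos mult_zero_right)
    moreover have "poly (map_poly of_rat (prod ?C S)) ?x \<noteq> 0"
    proof -
      have "poly (map_poly of_rat (?C c)) ?x \<noteq> 0" if "c \<in> S" for c
      proof (rule C_poly_nonroot)
        have "c dvd m" using that insert by auto
        then show "2 ^ (k + 1) * c > 0" using m by (auto intro!: Nat.gr0I)
        show "2 ^ (k + 1) * c \<noteq> 2 ^ (k + 1) * d" using that insert by auto
      qed (use \<open>d > 0\<close> in auto)
      then show ?thesis using insert.hyps by (simp only: poly_map_poly_of_rat_prod) simp
    qed
    ultimately have "poly (map_poly of_rat g) ?x = 0"
      unfolding g by (simp add: map_poly_of_rat_mult)
    then have "?C d dvd g"
      using \<open>d > 0\<close> by (intro is_min_poly_rat_dvd[OF is_min_poly_rat_C_poly]) simp_all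
    then have "prod ?C S * ?C d dvd t_hat n" unfolding g by (rule mult_dvd_mono[OF dvd_refl])
    then show ?case using insert.hyps by (simp add: mult.commute)
  qed simp
qed

text \<open>Cancelling the gcd of \<open>i\<close> and \<open>m\<close> turns the angle into
  \<open>j\<close> times pi over \<open>2 ^ (k + 1) * d\<close>. Here \<open>j\<close> is odd and
  coprime to \<open>d\<close>, so the root belongs to the factor of index \<open>d\<close>.\<close>

lemma prod_C_poly_root:
  assumes n: "n = 2 ^ k * m" "n \<ge> 1" "odd m" and i: "odd i"
  shows "poly (map_poly of_rat (\<Prod>d | d dvd m. C_poly (2 ^ (k + 1) * d)))
    (2 * cos (real i * pi / real (2 * n))) = 0"
proof -
  have m: "m > 0" using n by auto
  define e where "e = gcd i m"
  define j where "j = i div e"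
  define d where "d = m div e"
  have e: "e > 0" "i = j * e" "m = d * e" using m by (auto simp: e_def j_def d_def)
  have "coprime j d" unfolding j_def d_def e_def using m by (intro div_gcd_coprime) auto
  moreover have "odd j" using i e by auto
  ultimately have "coprime j (2 ^ (k + 1) * d)" by simp
  moreover have "d > 0" using e m by auto
  ultimately have "poly (map_poly of_rat (C_poly (2 ^ (k + 1) * d)))
      (2 * cos (real j * pi / real (2 ^ (k + 1) * d))) = 0"
    by (intro C_poly_root_coprime) auto
  moreover have "real j * pi / real (2 ^ (k + 1) * d) = real i * pi / real (2 * n)"
    using e \<open>d > 0\<close> n(1) by (simp add: field_simps)
  moreover have "d dvd m" using e by simp
  moreover have "finite {d. d dvd m}" using m by simp
  ultimately show ?thesis
    unfolding poly_map_poly_of_rat_prod by (intro prod_zero) (auto intro!: bexI[of _ d])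
qed

theorem mainTheorem8:
  fixes n k m :: nat
  assumes "n \<ge> 1" and "n = 2 ^ k * m" and "odd m"
  shows "t_hat n = (\<Prod>d | d dvd m. C_poly (2 * n div d))
       \<and> (\<Prod>d | d dvd m. C_poly (2 * n div d)) = (\<Prod>d | d dvd m. C_poly (2 ^ (k + 1) * d))"
proof -
  let ?P = "\<Prod>d | d dvd m. C_poly (2 ^ (k + 1) * d)"
  have m: "m > 0" using assms by auto
  have md: "m div d dvd m \<and> m div (m div d) = d" if dvd: "d dvd m" for d
  proof -
    obtain e where "m = d * e" using dvd by (rule dvdE)
    then show ?thesis using m by simp
  qed
  \<comment> \<open>The two products differ by the involution sending \<open>d\<close> to the
    complementary divisor \<open>m div d\<close>.\<close>
  have eq: "(\<Prod>d | d dvd m. C_poly (2 * n div d)) = ?P"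
  proof (rule prod.reindex_bij_witness[of _ "\<lambda>d. m div d" "\<lambda>d. m div d"])
    fix d assume "d \<in> {d. d dvd m}"
    then have "2 ^ (k + 1) * (m div d) = 2 ^ (k + 1) * m div d" by (intro div_mult_swap) simp
    also have "2 ^ (k + 1) * m = 2 * n" unfolding assms(2) by simp
    finally show "C_poly (2 ^ (k + 1) * (m div d)) = C_poly (2 * n div d)" by (rule arg_cong)
  qed (simp_all add: md)
  have "?P dvd t_hat n" using assms by (intro prod_C_poly_dvd_t_hat) auto
  then obtain g where g: "t_hat n = ?P * g" by (elim dvdE)
  have t0: "(t_hat n :: rat poly) \<noteq> 0" using monic_t_hat(2)[OF assms(1), where 'a = rat] by auto
  then have P0: "?P \<noteq> 0" and g0: "g \<noteq> 0" by (auto simp: g)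
  \<comment> \<open>For \<open>i < n\<close> these angles lie between 0 and pi, where the cosine is
    injective.\<close>
  let ?x = "\<lambda>i. 2 * cos (real (2 * i + 1) * pi / real (2 * n))"
  have inj: "inj_on ?x {..<n}"
  proof (rule inj_onI)
    fix i j assume ij: "i \<in> {..<n}" "j \<in> {..<n}" "?x i = ?x j"
    have "real (2 * l + 1) * pi / real (2 * n) \<le> pi" if "l < n" for l
    proof -
      have "real (2 * l + 1) * pi \<le> real (2 * n) * pi" using that by (intro mult_right_mono) auto
      then show ?thesis using assms(1) by (simp add: field_simps)
    qed
    then have "real (2 * i + 1) * pi / real (2 * n) = real (2 * j + 1) * pi / real (2 * n)"
      using ij by - (rule cos_inj_pi; simp)
    then show "i = j" using assms(1) by simp
  qed
  have R0: "(map_poly of_rat ?P :: real poly) \<noteq> 0"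
    using P0 by (simp add: map_poly_eq_0_iff)
  \<comment> \<open>The \<open>n\<close> distinct roots force the product to have degree at least
    \<open>n\<close>, so the cofactor \<open>g\<close> is constant; comparing leading coefficients
    makes it 1.\<close>
  have "n = card (?x ` {..<n})" using inj by (simp add: card_image)
  also have "\<dots> \<le> card {x :: real. poly (map_poly of_rat ?P) x = 0}"
    by (intro card_mono[OF poly_roots_finite[OF R0]] image_subsetI CollectI
        prod_C_poly_root[OF assms(2,1,3)]) simp
  also have "\<dots> \<le> degree (map_poly of_rat ?P :: real poly)"
    using R0 by (rule card_poly_roots_bound)
  also have "\<dots> = degree ?P" by (rule degree_map_poly) simp
  finally have "n \<le> degree ?P" .
  moreover have "degree (t_hat n :: rat poly) = degree ?P + degree g"
    unfolding g by (rule degree_mult_eq[OF P0 g0])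
  ultimately have "degree g = 0" using monic_t_hat(1)[OF assms(1), where 'a = rat] by linarith
  then obtain c where c: "g = [:c:]" by (rule degree_eq_zeroE)
  have lP: "lead_coeff ?P = 1"
    unfolding lead_coeff_prod
  proof (rule prod.neutral, rule ballI)
    fix d assume "d \<in> {d. d dvd m}"
    then have "d > 0" using m by (auto dest: dvd_pos_nat)
    then show "lead_coeff (C_poly (2 ^ (k + 1) * d)) = 1"
      using is_min_poly_rat_C_poly[of "2 ^ (k + 1) * d"] by (simp add: is_min_poly_rat_def)
  qed
  have "lead_coeff (t_hat n :: rat poly) = lead_coeff ?P * lead_coeff g"
    unfolding g by (rule lead_coeff_mult)
  then have "c = 1" unfolding lP monic_t_hat(2)[OF assms(1)] c by simp
  then have "t_hat n = ?P" unfolding g c by (simp only: one_pCons[symmetric] mult_1_right)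
  then show ?thesis unfolding eq by blast
qed

end
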